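(* Let $\mathcal{O}$ be a diffeological orbifold and let $\pi:\mathcal{E}\to\mathcal{O}$ be a diffeological étale map from a diffeological space $\mathcal{E}$ (i.e. $\mathcal{E}$ is a diffeological étale space on $\mathcal{O}$). Then $\mathcal{E}$ is a diffeological orbifold.
   Context: An $n$-domain is an open subset of $\mathbb{R}^n$; a domain is an $n$-domain for some $n\ge 0$. A parametrization in a set $X$ is a map from a domain to $X$. A diffeology on $X$ is a set $\mathcal{D}$ of parametrizations in $X$ such that: (D1) the images of the elements of $\mathcal{D}$ cover $X$; (D2) $P\circ F\in\mathcal{D}$ for every $P:U\to X$ in $\mathcal{D}$ and every smooth map $F:V\to U$ between domains; (D3) if a family of $n$-parametrizations $P_i:U_i\to X$ in $\mathcal{D}$ agree on overlaps, their common extension to $\bigcup_i U_i$ is in $\mathcal{D}$. A diffeological space is a set with a diffeology, whose elements are called plots. A map $f:X\to Y$ is smooth if $f\circ P$ is a plot in $Y$ for every plot $P$ in $X$; a diffeomorphism is a smooth bijection with smooth inverse. A subset of $X$ is D-open if its preimage under every plot is open. Subsets carry the subspace diffeology (plots with values in the subset), and the plots of a product are the tuples of plots. Domains carry their usual smooth parametrizations as plots. A quotient $q:X\to X/R$ carries the quotient diffeology, whose plots are the parametrizations that are locally of the form $q\circ P$ with $P$ a plot in $X$. For smooth maps $f:X\to Y$ and $g:Z\to Y$, the pullback of $f$ by $g$ is $g^*f:g^*X\to Z$, $(z,x)\mapsto z$, where $g^*X=\{(z,x)\in Z\times X: g(z)=f(x)\}$. Diffeological $n$-orbifold: a diffeological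 space $\mathcal{O}$ such that each point $x\in\mathcal{O}$ has a D-open neighborhood $\widetilde{U}\subseteq\mathcal{O}$ for which there is a diffeomorphism $U/G\to\widetilde{U}$, where $G\subseteq\mathrm{GL}(n,\mathbb{R})$ is a finite subgroup, $U$ is a connected $G$-invariant $n$-domain, and $U/G$ is the quotient of $U$ by the action of $G$. A diffeological orbifold is a diffeological $n$-orbifold for some $n$. Étale map: a map $f:X\to Y$ such that every $x_0\in X$ has a D-open neighborhood $O\subseteq X$, and $f(x_0)$ a D-open neighborhood $O'\subseteq Y$, with $f|_O:O\to O'$ a diffeomorphism. Diffeological étale map: a smooth map (not required to be surjective or injective) whose pullback by every plot in the target is étale. *)

theory Defs
  imports "HOL-Analysis.Analysis" "Jordan_Normal_Form.Matrix"
begin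

section \<open>Domains and smooth maps between them\<close>

text \<open>
  Diffeologies quantify over all dimensions at once, so points of Euclidean n-space are the
  functions \<^typ>\<open>nat \<Rightarrow> real\<close> vanishing from index \<open>n\<close> on, topologized by the library's
  \<^const>\<open>Euclidean_space\<close>.
\<close>

abbreviation is_domain :: "nat \<Rightarrow> (nat \<Rightarrow> real) set \<Rightarrow> bool" where
  "is_domain n U \<equiv> openin (Euclidean_space n) U"

definition partial_deriv :: "nat \<Rightarrow> ((nat \<Rightarrow> real) \<Rightarrow> real) \<Rightarrow> ((nat \<Rightarrow> real) \<Rightarrow> real)" where
  "partial_deriv i f = (\<lambda>x. deriv (\<lambda>t. f (x(i := t))) (x i))"

text \<open>
  Infinitely differentiable: all iterated partial derivatives exist and are continuous on \<open>U\<close>.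
  Only values on \<open>U\<close> matter when \<open>U\<close> is an n-domain.
\<close>

definition smooth_function :: "nat \<Rightarrow> (nat \<Rightarrow> real) set \<Rightarrow> ((nat \<Rightarrow> real) \<Rightarrow> real) \<Rightarrow> bool" where
  "smooth_function n U f \<longleftrightarrow>
     (\<forall>ks. set ks \<subseteq> {..<n} \<longrightarrow>
        continuous_map (subtopology (Euclidean_space n) U) euclideanreal (foldr partial_deriv ks f) \<and>
        (\<forall>i<n. \<forall>x\<in>U. (\<lambda>t. foldr partial_deriv ks f (x(i := t))) differentiable (at (x i))))"

definition smooth_domain_map ::
    "nat \<Rightarrow> (nat \<Rightarrow> real) set \<Rightarrow> nat \<Rightarrow> (nat \<Rightarrow> real) set \<Rightarrow> ((nat \<Rightarrow> real) \<Rightarrow> (nat \<Rightarrow> real)) \<Rightarrow> bool" where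
  "smooth_domain_map m V n U F \<longleftrightarrow>
     is_domain m V \<and> is_domain n U \<and> F \<in> V \<rightarrow> U \<and>
     (\<forall>j<n. smooth_function m V (\<lambda>x. F x j))"


section \<open>Diffeological spaces\<close>

text \<open>
  A parametrization is a triple of its dimension, its domain and its map, the map being
  extensional so that it is determined by its values on the domain. The dimension is recorded
  because the empty set is an n-domain for every n.
\<close>

type_synonym 'a param = "nat \<times> (nat \<Rightarrow> real) set \<times> ((nat \<Rightarrow> real) \<Rightarrow> 'a)"

definition parametrizations :: "'a set \<Rightarrow> 'a param set" where
  "parametrizations X = {(n, U, P). is_domain n U \<and> P \<in> U \<rightarrow>\<^sub>E X}"

record 'a dspace =
  points :: "'a set"
  plots :: "'a param set"

text \<open>
  In \<open>gluing\<close>, the family is given as a set of (domain, map) pairs; its members agree on overlaps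
  precisely when a common extension \<open>Q\<close> exists.
\<close>

locale diffeological_space =
  fixes X :: "'a dspace"
  assumes plots_parametrizations: "plots X \<subseteq> parametrizations (points X)"
    and covering: "(\<Union>(n, U, P) \<in> plots X. P ` U) = points X"
    and smooth_compatibility:
      "\<lbrakk>(n, U, P) \<in> plots X; smooth_domain_map m V n U F\<rbrakk> \<Longrightarrow> (m, V, compose V P F) \<in> plots X"
    and gluing:
      "\<lbrakk>\<forall>(U, P) \<in> \<P>. (n, U, P) \<in> plots X; Q \<in> extensional (\<Union>(U, P) \<in> \<P>. U);
        \<forall>(U, P) \<in> \<P>. \<forall>x\<in>U. Q x = P x\<rbrakk> \<Longrightarrow> (n, \<Union>(U, P) \<in> \<P>. U, Q) \<in> plots X"

definition dsmooth :: "'a dspace \<Rightarrow> 'b dspace \<Rightarrow> ('a \<Rightarrow> 'b) \<Rightarrow> bool" where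
  "dsmooth X Y f \<longleftrightarrow> f \<in> points X \<rightarrow> points Y \<and>
     (\<forall>(n, U, P) \<in> plots X. (n, U, compose U f P) \<in> plots Y)"

definition diffeomorphism :: "'a dspace \<Rightarrow> 'b dspace \<Rightarrow> ('a \<Rightarrow> 'b) \<Rightarrow> bool" where
  "diffeomorphism X Y f \<longleftrightarrow> bij_betw f (points X) (points Y) \<and>
     dsmooth X Y f \<and> dsmooth Y X (inv_into (points X) f)"

definition D_open :: "'a dspace \<Rightarrow> 'a set \<Rightarrow> bool" where
  "D_open X A \<longleftrightarrow> A \<subseteq> points X \<and> (\<forall>(n, U, P) \<in> plots X. is_domain n (U \<inter> P -` A))"

text \<open>Used for subsets \<open>A\<close> of \<open>points X\<close>.\<close>

definition subspace_of :: "'a dspace \<Rightarrow> 'a set \<Rightarrow> 'a dspace" where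
  "subspace_of X A = \<lparr>points = A, plots = {(n, U, P). (n, U, P) \<in> plots X \<and> P ` U \<subseteq> A}\<rparr>"

definition product_space :: "'a dspace \<Rightarrow> 'b dspace \<Rightarrow> ('a \<times> 'b) dspace" where
  "product_space X Y = \<lparr>points = points X \<times> points Y,
     plots = {(n, U, P). (n, U, P) \<in> parametrizations (points X \<times> points Y) \<and>
       (n, U, compose U fst P) \<in> plots X \<and> (n, U, compose U snd P) \<in> plots Y}\<rparr>"

definition domain_space :: "nat \<Rightarrow> (nat \<Rightarrow> real) set \<Rightarrow> (nat \<Rightarrow> real) dspace" where
  "domain_space n U = \<lparr>points = U,
     plots = {(m, V, F). (m, V, F) \<in> parametrizations U \<and> smooth_domain_map m V n U F}\<rparr>"

text \<open>Used for equivalence relations \<open>R\<close> on \<open>points X\<close>.\<close>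

definition quotient_space :: "'a dspace \<Rightarrow> ('a \<times> 'a) set \<Rightarrow> 'a set dspace" where
  "quotient_space X R = \<lparr>points = points X // R,
     plots = {(n, V, Q). (n, V, Q) \<in> parametrizations (points X // R) \<and>
       (\<forall>v\<in>V. \<exists>W P. v \<in> W \<and> W \<subseteq> V \<and> (n, W, P) \<in> plots X \<and> (\<forall>w\<in>W. Q w = R `` {P w}))}\<rparr>"

text \<open>The total space of the pullback of \<open>f : X \<rightarrow> Y\<close> by \<open>g : Z \<rightarrow> Y\<close>; the pullback map itself is \<^const>\<open>fst\<close>.\<close>

definition pullback_space :: "'z dspace \<Rightarrow> 'a dspace \<Rightarrow> ('z \<Rightarrow> 'b) \<Rightarrow> ('a \<Rightarrow> 'b) \<Rightarrow> ('z \<times> 'a) dspace" where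
  "pullback_space Z X g f =
     subspace_of (product_space Z X) {(z, x) \<in> points Z \<times> points X. g z = f x}"


section \<open>Diffeological orbifolds\<close>

abbreviation GL_group :: "nat \<Rightarrow> real mat monoid" where
  "GL_group n \<equiv> units_of (ring_mat TYPE(real) n ())"

definition mat_action :: "nat \<Rightarrow> real mat \<Rightarrow> (nat \<Rightarrow> real) \<Rightarrow> (nat \<Rightarrow> real)" where
  "mat_action n A x = (\<lambda>i. if i < n then \<Sum>j<n. A $$ (i, j) * x j else 0)"

definition orbit_relation ::
    "nat \<Rightarrow> real mat set \<Rightarrow> (nat \<Rightarrow> real) set \<Rightarrow> ((nat \<Rightarrow> real) \<times> (nat \<Rightarrow> real)) set" where
  "orbit_relation n G U = {(x, y) \<in> U \<times> U. \<exists>A\<in>G. y = mat_action n A x}"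

definition diffeological_orbifold_dim :: "nat \<Rightarrow> 'a dspace \<Rightarrow> bool" where
  "diffeological_orbifold_dim n X \<longleftrightarrow> diffeological_space X \<and>
     (\<forall>x \<in> points X. \<exists>U' G U f.
        D_open X U' \<and> x \<in> U' \<and>
        finite G \<and> subgroup G (GL_group n) \<and>
        is_domain n U \<and> connectedin (Euclidean_space n) U \<and> (\<forall>A\<in>G. mat_action n A ` U \<subseteq> U) \<and>
        diffeomorphism (quotient_space (domain_space n U) (orbit_relation n G U)) (subspace_of X U') f)"

definition diffeological_orbifold :: "'a dspace \<Rightarrow> bool" where
  "diffeological_orbifold X \<longleftrightarrow> (\<exists>n. diffeological_orbifold_dim n X)"


section \<open>Etale maps\<close>

definition etale_map :: "'a dspace \<Rightarrow> 'b dspace \<Rightarrow> ('a \<Rightarrow> 'b) \<Rightarrow> bool" where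
  "etale_map X Y f \<longleftrightarrow> f \<in> points X \<rightarrow> points Y \<and>
     (\<forall>x \<in> points X. \<exists>A B. D_open X A \<and> x \<in> A \<and> D_open Y B \<and> f x \<in> B \<and>
        diffeomorphism (subspace_of X A) (subspace_of Y B) (restrict f A))"

definition diffeological_etale_map :: "'a dspace \<Rightarrow> 'b dspace \<Rightarrow> ('a \<Rightarrow> 'b) \<Rightarrow> bool" where
  "diffeological_etale_map X Y f \<longleftrightarrow> dsmooth X Y f \<and>
     (\<forall>(n, U, P) \<in> plots Y.
        etale_map (pullback_space (domain_space n U) X P f) (domain_space n U) fst)"

end

theory Submission
  imports Defs
begin

text \<open>
  Take a chart \<open>q : U \<rightarrow> \<O>\<close>, invariant under \<open>G\<close>, and \<open>u \<in> U\<close> with \<open>q u = \<pi> e\<close>. Pulling \<open>\<pi>\<close> back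
  along the plot \<open>q\<close> gives an etale map onto a neighbourhood of \<open>u\<close>, hence a local section \<open>s\<close>
  with \<open>\<pi> \<circ> s = q\<close> and \<open>s u = e\<close>. On a small connected neighbourhood \<open>W\<close> of \<open>u\<close> that is invariant
  under the stabilizer \<open>H\<close> of \<open>u\<close> and moved off itself by \<open>G - H\<close>, the section identifies
  exactly the \<open>H\<close>-orbits. A plot \<open>P\<close> of \<open>\<E>\<close> through \<open>s w\<close> lifts: lift \<open>\<pi> \<circ> P\<close> to \<open>R\<close> along \<open>q\<close>
  with \<open>R\<close> passing through \<open>w\<close>; then \<open>(R, P)\<close> is a plot of the pullback, so near the given
  point it stays in the sheet of \<open>s\<close>, where \<open>P = s \<circ> R\<close>. Hence \<open>s\<close> is a chart \<open>W/H\<close> of \<open>\<E>\<close>.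
\<close>

section \<open>Smooth maps between domains\<close>

text \<open>A partial derivative sees a function only along a coordinate line. A short piece of that
  line stays inside the open set, so identities valid on \<open>V\<close> may be
  differentiated.\<close>

lemma eventually_fun_upd_mem_domain:
  assumes "is_domain n V" and "x \<in> V" and "k < n"
  shows "\<forall>\<^sub>F t in nhds (x k). x(k := t) \<in> V"
proof -
  have x: "x \<in> topspace (Euclidean_space n)"
    using assms openin_subset by blast
  have "continuous_map euclideanreal (Euclidean_space n) (\<lambda>t. x(k := t))"
    unfolding Euclidean_space_def continuous_map_in_subtopology continuous_map_componentwise_UNIV
    using x \<open>k < n\<close> by (auto simp: topspace_Euclidean_space)
  from openin_continuous_map_preimage[OF this assms(1)] have "open {t. x(k := t) \<in> V}"
    by simp
  from eventually_nhds_in_open[OF this, of "x k"] show ?thesis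
    using assms(2) by simp
qed

text \<open>Induction on the list of directions: each differentiation is linear, and smoothness of
  the summands supplies the derivatives needed.\<close>

lemma foldr_partial_deriv_sum:
  assumes "is_domain n V" and "\<And>j. j \<in> J \<Longrightarrow> smooth_function n V (f j)"
    and "\<And>x. x \<in> V \<Longrightarrow> F x = (\<Sum>j\<in>J. c j * f j x)"
    and "set ks \<subseteq> {..<n}" and "x \<in> V"
  shows "foldr partial_deriv ks F x = (\<Sum>j\<in>J. c j * foldr partial_deriv ks (f j) x)"
  using assms(4,5)
proof (induction ks arbitrary: x)
  case Nil
  then show ?case using assms(3) by simp
next
  case (Cons k ks)
  let ?D = "\<lambda>f t. foldr partial_deriv ks f (x(k := t))"
  \<comment> \<open>\<open>F\<close> is constrained on \<open>V\<close> only, so the two sides agree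
    near \<open>x k\<close> and not everywhere; \<open>deriv\<close> depends only on this
    germ.\<close>
  have ev: "\<forall>\<^sub>F t in nhds (x k). ?D F t = (\<Sum>j\<in>J. c j * ?D (f j) t)"
    using eventually_fun_upd_mem_domain[OF assms(1) Cons.prems(2), of k] Cons
    by (auto elim!: eventually_mono)
  have "DERIV (?D (f j)) (x k) :> deriv (?D (f j)) (x k)" if "j \<in> J" for j
    using assms(2)[OF that] Cons.prems
    by (simp add: DERIV_deriv_iff_real_differentiable smooth_function_def)
  then have "DERIV (\<lambda>t. \<Sum>j\<in>J. c j * ?D (f j) t) (x k) :>
      (\<Sum>j\<in>J. c j * deriv (?D (f j)) (x k))"
    by (auto intro!: DERIV_sum DERIV_cmult)
  then have "deriv (\<lambda>t. \<Sum>j\<in>J. c j * ?D (f j) t) (x k) = (\<Sum>j\<in>J. c j * deriv (?D (f j)) (x k))"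
    by (rule DERIV_imp_deriv)
  moreover have "deriv (?D F) (x k) = deriv (\<lambda>t. \<Sum>j\<in>J. c j * ?D (f j) t) (x k)"
    by (rule deriv_cong_ev[OF ev refl])
  ultimately show ?case
    by (simp add: partial_deriv_def[of k])
qed

text \<open>Serves two purposes: a one-term sum with coefficient 1 gives invariance under changes
  off \<open>V\<close>, and a matrix row as coefficients gives smoothness of linear actions.\<close>

lemma smooth_function_sum:
  assumes V: "is_domain n V" and f: "\<And>j. j \<in> J \<Longrightarrow> smooth_function n V (f j)"
    and F: "\<And>x. x \<in> V \<Longrightarrow> F x = (\<Sum>j\<in>J. c j * f j x)" and "finite J"
  shows "smooth_function n V F"
  unfolding smooth_function_def
proof (intro allI impI conjI ballI)
  fix ks :: "nat list"
  assume ks: "set ks \<subseteq> {..<n}"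
  have eq: "foldr partial_deriv ks F x = (\<Sum>j\<in>J. c j * foldr partial_deriv ks (f j) x)"
    if "x \<in> V" for x
    using foldr_partial_deriv_sum[OF V f F ks that] by blast
  have "continuous_map (subtopology (Euclidean_space n) V) euclideanreal
      (\<lambda>x. \<Sum>j\<in>J. c j * foldr partial_deriv ks (f j) x)"
    using f ks \<open>finite J\<close>
    by (intro continuous_map_sum continuous_map_real_mult_left) (auto simp: smooth_function_def)
  then show "continuous_map (subtopology (Euclidean_space n) V) euclideanreal (foldr partial_deriv ks F)"
    by (rule continuous_map_eq) (simp add: eq)
  fix i x
  assume "i < n" "x \<in> V"
  let ?D = "\<lambda>f t. foldr partial_deriv ks f (x(i := t))"
  have "(\<lambda>t. \<Sum>j\<in>J. c j * ?D (f j) t) differentiable at (x i)"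
    using f ks \<open>i < n\<close> \<open>x \<in> V\<close> \<open>finite J\<close>
    by (intro differentiable_sum ballI differentiable_mult) (auto simp: smooth_function_def)
  then obtain D where "DERIV (\<lambda>t. \<Sum>j\<in>J. c j * ?D (f j) t) (x i) :> D"
    by (auto simp: real_differentiable_def)
  moreover have "\<forall>\<^sub>F t in nhds (x i). ?D F t = (\<Sum>j\<in>J. c j * ?D (f j) t)"
    using eventually_fun_upd_mem_domain[OF V \<open>x \<in> V\<close> \<open>i < n\<close>] eq
    by (auto elim!: eventually_mono)
  ultimately have "DERIV (?D F) (x i) :> D"
    by (simp add: DERIV_cong_ev)
  then show "?D F differentiable at (x i)"
    by (auto simp: real_differentiable_def)
qed

lemma smooth_function_cong:
  assumes "is_domain n V" and "smooth_function n V f" and "\<And>x. x \<in> V \<Longrightarrow> F x = f x"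
  shows "smooth_function n V F"
  using smooth_function_sum[OF assms(1), of "{()}" "\<lambda>_. f" F "\<lambda>_. 1"] assms by simp

lemma smooth_function_subset:
  assumes "smooth_function n V f" and "W \<subseteq> V"
  shows "smooth_function n W f"
  using assms unfolding smooth_function_def
  by (meson continuous_map_from_subtopology_mono subsetD)

text \<open>The coordinate together with all constant functions is closed under
  \<open>partial_deriv\<close>, so every iterated derivative is one of these.\<close>

lemma smooth_function_coordinate: "smooth_function n V (\<lambda>x. x j)"
proof -
  have *: "foldr partial_deriv ks (\<lambda>x. x j) \<in> insert (\<lambda>x. x j) (range (\<lambda>c _. c))" for ks
  proof (induction ks)
    case (Cons k ks)
    have "partial_deriv k (\<lambda>x. x j) = (\<lambda>_. if k = j then 1 else 0)"
      by (auto simp: partial_deriv_def)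
    moreover have "partial_deriv k (\<lambda>_. c) = (\<lambda>_. 0)" for c
      by (auto simp: partial_deriv_def)
    ultimately show ?case
      using Cons by auto
  qed simp
  have cont: "continuous_map (subtopology (Euclidean_space n) V) euclideanreal (\<lambda>x. x j)"
    unfolding Euclidean_space_def
    by (intro continuous_map_from_subtopology) (metis UNIV_I continuous_map_product_coordinates)
  have diff: "(\<lambda>t. (x(i := t)) j) differentiable at (x i)" for x :: "nat \<Rightarrow> real" and i
    by (cases "i = j") auto
  show ?thesis
    unfolding smooth_function_def
  proof (intro allI impI conjI ballI)
    fix ks
    consider "foldr partial_deriv ks (\<lambda>x. x j) = (\<lambda>x. x j)"
      | c where "foldr partial_deriv ks (\<lambda>x. x j) = (\<lambda>_. c)"
      using *[of ks] by blast
    note c = this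
    show "continuous_map (subtopology (Euclidean_space n) V) euclideanreal (foldr partial_deriv ks (\<lambda>x. x j))"
      using c by cases (simp_all add: cont)
    show "(\<lambda>t. foldr partial_deriv ks (\<lambda>x. x j) (x(i := t))) differentiable at (x i)" for i x
      using c by cases (simp_all only: diff differentiable_const)
  qed
qed

section \<open>Inclusions, restrictions, preimages and linear images of smooth maps\<close>

lemma smooth_domain_map_inclusion:
  assumes "is_domain n V" and "is_domain n U" and "V \<subseteq> U"
  shows "smooth_domain_map n V n U (restrict id V)"
  unfolding smooth_domain_map_def
  using assms by (auto intro!: smooth_function_cong[OF _ smooth_function_coordinate])

lemma smooth_domain_map_restrict:
  assumes F: "smooth_domain_map m V n U F" and "is_domain m V'" and "V' \<subseteq> V"
    and "is_domain n U'" and "F ` V' \<subseteq> U'"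
  shows "smooth_domain_map m V' n U' (restrict F V')"
  unfolding smooth_domain_map_def
proof (intro conjI allI impI)
  fix j assume "j < n"
  then have "smooth_function m V' (\<lambda>x. F x j)"
    using F \<open>V' \<subseteq> V\<close> smooth_function_subset by (auto simp: smooth_domain_map_def)
  then show "smooth_function m V' (\<lambda>x. restrict F V' x j)"
    by (rule smooth_function_cong[OF \<open>is_domain m V'\<close>]) auto
qed (use assms in auto)

lemma openin_smooth_domain_map_preimage:
  assumes F: "smooth_domain_map m V n U F" and "is_domain n W"
  shows "is_domain m {v \<in> V. F v \<in> W}"
proof -
  have V: "is_domain m V" and U: "is_domain n U" and FV: "F \<in> V \<rightarrow> U"
    using F by (auto simp: smooth_domain_map_def)
  have "continuous_map (subtopology (Euclidean_space m) V) euclideanreal (\<lambda>x. F x j)" if "j < n" for j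
  proof -
    have "smooth_function m V (\<lambda>x. F x j)"
      using F that by (simp add: smooth_domain_map_def)
    \<comment> \<open>The empty list of derivatives in \<open>smooth_function\<close> yields
      continuity of the component itself.\<close>
    then show ?thesis
      unfolding smooth_function_def by (auto dest: spec[of _ "[]"])
  qed
  \<comment> \<open>The componentwise criterion speaks of maps truncated at index \<open>n\<close>.
    On \<open>V\<close> the truncation is \<open>F\<close>, since points of \<open>U\<close> vanish
    from \<open>n\<close> on.\<close>
  then have "continuous_map (subtopology (Euclidean_space m) V) (Euclidean_space n)
      (\<lambda>x i. if i < n then F x i else 0)"
    by (subst continuous_map_componentwise_Euclidean_space) auto
  moreover have "(\<lambda>i. if i < n then F x i else 0) = F x" if "x \<in> V" for x
    using that FV openin_subset[OF U] by (fastforce simp: topspace_Euclidean_space)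
  ultimately have "continuous_map (subtopology (Euclidean_space m) V) (Euclidean_space n) F"
    by (auto elim!: continuous_map_eq)
  then have "openin (subtopology (Euclidean_space m) V)
      {x \<in> topspace (subtopology (Euclidean_space m) V). F x \<in> W}"
    using openin_continuous_map_preimage assms(2) by blast
  moreover have "{x \<in> topspace (subtopology (Euclidean_space m) V). F x \<in> W} = {v \<in> V. F v \<in> W}"
    using openin_subset[OF V] by auto
  ultimately show ?thesis
    using openin_trans_full[OF _ V] by simp
qed

text \<open>Each component is a linear combination of the components of \<open>F\<close>, with a row
  of \<open>A\<close> as coefficients.\<close>

lemma smooth_domain_map_mat_action:
  assumes F: "smooth_domain_map m V n U F" and "mat_action n A ` U \<subseteq> U"
  shows "smooth_domain_map m V n U (\<lambda>v\<in>V. mat_action n A (F v))"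
  unfolding smooth_domain_map_def
proof (intro conjI allI impI)
  fix i assume "i < n"
  show "smooth_function m V (\<lambda>x. (\<lambda>v\<in>V. mat_action n A (F v)) x i)"
    by (rule smooth_function_sum[where J = "{..<n}" and f = "\<lambda>j x. F x j" and c = "\<lambda>j. A $$ (i, j)"])
      (use F \<open>i < n\<close> in \<open>auto simp: smooth_domain_map_def mat_action_def\<close>)
qed (use assms in \<open>auto simp: smooth_domain_map_def\<close>)


section \<open>Finite linear group actions\<close>

lemma mat_action_mult:
  assumes "A \<in> carrier_mat n n" and "B \<in> carrier_mat n n"
  shows "mat_action n (A * B) x = mat_action n A (mat_action n B x)"
proof
  fix i
  show "mat_action n (A * B) x i = mat_action n A (mat_action n B x) i"
  proof (cases "i < n")
    case True
    then have "mat_action n (A * B) x i = (\<Sum>j<n. (\<Sum>k<n. A $$ (i, k) * B $$ (k, j)) * x j)"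
      using assms by (auto simp: mat_action_def scalar_prod_def atLeast0LessThan intro!: sum.cong)
    also have "\<dots> = (\<Sum>j<n. \<Sum>k<n. A $$ (i, k) * (B $$ (k, j) * x j))"
      by (simp add: sum_distrib_right mult.assoc)
    also have "\<dots> = (\<Sum>k<n. \<Sum>j<n. A $$ (i, k) * (B $$ (k, j) * x j))"
      by (rule sum.swap)
    also have "\<dots> = mat_action n A (mat_action n B x) i"
      using True by (simp add: mat_action_def sum_distrib_left)
    finally show ?thesis .
  qed (simp add: mat_action_def)
qed

text \<open>\<open>mat_action\<close> sets all coordinates from \<open>n\<close> on to 0, so the
  identity matrix acts trivially only on points of Euclidean n-space.\<close>

lemma mat_action_one:
  assumes "x \<in> topspace (Euclidean_space n)"
  shows "mat_action n (1\<^sub>m n) x = x"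
proof
  fix i
  have "(\<Sum>j<n. 1\<^sub>m n $$ (i, j) * x j) = (\<Sum>j<n. if j = i then x j else 0)" if "i < n"
    using that by (intro sum.cong) auto
  then show "mat_action n (1\<^sub>m n) x i = x i"
    using assms by (auto simp: mat_action_def topspace_Euclidean_space)
qed

lemma continuous_map_mat_action:
  "continuous_map (Euclidean_space n) (Euclidean_space n) (mat_action n A)"
proof -
  have "continuous_map (Euclidean_space n) euclideanreal (\<lambda>x. x j)" for j
    unfolding Euclidean_space_def
    by (intro continuous_map_from_subtopology) (metis UNIV_I continuous_map_product_coordinates)
  then show ?thesis
    unfolding mat_action_def continuous_map_componentwise_Euclidean_space
    by (intro allI impI continuous_map_sum continuous_map_real_mult_left) auto
qed

section \<open>Subgroups of the general linear group and their orbits\<close>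

lemma group_GL: "group (GL_group n)"
  by (intro monoid.units_group ring.is_monoid ring_mat)

text \<open>Translates the group of units of the matrix ring into plain matrix products, the form to
  which \<open>mat_action_mult\<close> applies.\<close>

lemma subgroup_GL_facts:
  assumes "subgroup G (GL_group n)"
  shows "A \<in> G \<Longrightarrow> A \<in> carrier_mat n n"
    and "A \<in> G \<Longrightarrow> B \<in> G \<Longrightarrow> A * B \<in> G"
    and "1\<^sub>m n \<in> G"
    and "A \<in> G \<Longrightarrow> \<exists>B\<in>G. B * A = 1\<^sub>m n"
proof -
  interpret subgroup G "GL_group n" by fact
  show "A \<in> carrier_mat n n" if "A \<in> G"
    using subset that by (auto simp: units_of_def Units_def ring_mat_def)
  show "A \<in> G \<Longrightarrow> B \<in> G \<Longrightarrow> A * B \<in> G"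
    using m_closed[of A B] by (simp add: units_of_mult ring_mat_simps)
  show "1\<^sub>m n \<in> G"
    using one_closed by (simp add: units_of_one ring_mat_simps)
  show "\<exists>B\<in>G. B * A = 1\<^sub>m n" if "A \<in> G"
  proof
    show "inv\<^bsub>GL_group n\<^esub> A * A = 1\<^sub>m n"
      using group.l_inv[OF group_GL, of A] subset that
      by (auto simp: units_of_mult units_of_one ring_mat_simps)
  qed (use that in simp)
qed

lemma subgroup_GL_stabilizer:
  assumes G: "subgroup G (GL_group n)" and u: "u \<in> topspace (Euclidean_space n)"
  shows "subgroup {A \<in> G. mat_action n A u = u} (GL_group n)"
proof (rule group.subgroupI[OF group_GL])
  interpret subgroup G "GL_group n" by fact
  let ?H = "{A \<in> G. mat_action n A u = u}"
  note facts = subgroup_GL_facts[OF G]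
  show "?H \<subseteq> carrier (GL_group n)"
    using subset by auto
  show "?H \<noteq> {}"
    using facts(3) mat_action_one[OF u] by auto
  fix A
  assume A: "A \<in> ?H"
  let ?B = "inv\<^bsub>GL_group n\<^esub> A"
  have B: "?B \<in> G" using A by simp
  have "?B * A = 1\<^sub>m n"
    using group.l_inv[OF group_GL, of A] subset A
    by (auto simp: units_of_mult units_of_one ring_mat_simps)
  then have "mat_action n ?B (mat_action n A u) = u"
    using mat_action_mult[OF facts(1)[OF B] facts(1), of A u] mat_action_one[OF u] A by simp
  then have "mat_action n ?B u = u"
    using A by simp
  then show "?B \<in> ?H" using B by simp
  fix B
  assume "B \<in> ?H"
  then show "A \<otimes>\<^bsub>GL_group n\<^esub> B \<in> ?H"
    using A facts(1,2) by (simp add: units_of_mult ring_mat_simps mat_action_mult)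
qed

lemma equiv_orbit_relation:
  assumes G: "subgroup G (GL_group n)" and U: "U \<subseteq> topspace (Euclidean_space n)"
    and inv: "\<And>A. A \<in> G \<Longrightarrow> mat_action n A ` U \<subseteq> U"
  shows "equiv U (orbit_relation n G U)"
proof (rule equivI)
  note facts = subgroup_GL_facts[OF G]
  show "orbit_relation n G U \<subseteq> U \<times> U"
    by (auto simp: orbit_relation_def)
  show "refl_on U (orbit_relation n G U)"
  proof (rule refl_onI)
    fix x assume "x \<in> U"
    then have "x = mat_action n (1\<^sub>m n) x"
      using U mat_action_one[of x n] by auto
    then show "(x, x) \<in> orbit_relation n G U"
      using \<open>x \<in> U\<close> facts(3) unfolding orbit_relation_def by blast
  qed
  show "sym (orbit_relation n G U)"
  proof (rule symI)
    fix x y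
    assume "(x, y) \<in> orbit_relation n G U"
    then obtain A where A: "x \<in> U" "y \<in> U" "A \<in> G" "y = mat_action n A x"
      by (auto simp: orbit_relation_def)
    obtain B where "B \<in> G" "B * A = 1\<^sub>m n"
      using facts(4)[OF A(3)] by auto
    then have "x = mat_action n B y"
      using A U mat_action_mult[of B n A x] mat_action_one[of x n] facts(1) by auto
    then show "(y, x) \<in> orbit_relation n G U"
      using A \<open>B \<in> G\<close> by (auto simp: orbit_relation_def)
  qed
  show "trans (orbit_relation n G U)"
  proof (rule transI)
    fix x y z
    assume "(x, y) \<in> orbit_relation n G U" "(y, z) \<in> orbit_relation n G U"
    then obtain A B where *: "x \<in> U" "z \<in> U" "A \<in> G" "B \<in> G"
      "z = mat_action n B (mat_action n A x)"
      by (auto simp: orbit_relation_def)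
    then have "z = mat_action n (B * A) x" "B * A \<in> G"
      using mat_action_mult facts(1,2) by auto
    then show "(x, z) \<in> orbit_relation n G U"
      using * by (auto simp: orbit_relation_def)
  qed
qed

text \<open>Intersecting the preimages of \<open>N\<close> under \<open>H\<close> gives an invariant
  open set. Its component at \<open>u\<close> is again invariant: each element of \<open>H\<close>
  maps it to a connected set that still contains the fixed point \<open>u\<close>.\<close>

lemma invariant_connected_neighbourhood:
  assumes H: "subgroup H (GL_group n)" and "finite H" and N: "is_domain n N" "u \<in> N"
    and fix_u: "\<And>A. A \<in> H \<Longrightarrow> mat_action n A u = u"
  obtains W where "is_domain n W" "connectedin (Euclidean_space n) W" "u \<in> W" "W \<subseteq> N"
    "\<And>A. A \<in> H \<Longrightarrow> mat_action n A ` W \<subseteq> W"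
proof -
  note facts = subgroup_GL_facts[OF H]
  define M where "M = {x \<in> topspace (Euclidean_space n). \<forall>A\<in>H. mat_action n A x \<in> N}"
  define W where "W = connected_component_of_set (subtopology (Euclidean_space n) M) u"
  have u: "u \<in> topspace (Euclidean_space n)"
    using N openin_subset by blast
  have M_eq: "M = (\<Inter>A\<in>H. {x \<in> topspace (Euclidean_space n). mat_action n A x \<in> N})"
    using facts(3) by (auto simp: M_def)
  have M: "is_domain n M"
    unfolding M_eq
  proof (rule openin_Inter)
    show "finite ((\<lambda>A. {x \<in> topspace (Euclidean_space n). mat_action n A x \<in> N}) ` H)"
      using \<open>finite H\<close> by simp
    show "(\<lambda>A. {x \<in> topspace (Euclidean_space n). mat_action n A x \<in> N}) ` H \<noteq> {}"
      using facts(3) by blast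
    show "is_domain n S"
      if "S \<in> (\<lambda>A. {x \<in> topspace (Euclidean_space n). mat_action n A x \<in> N}) ` H" for S
      using that openin_continuous_map_preimage[OF continuous_map_mat_action N(1)] by blast
  qed
  have "u \<in> M"
    using u N(2) fix_u by (simp add: M_def)
  have uM: "u \<in> topspace (subtopology (Euclidean_space n) M)"
    using u \<open>u \<in> M\<close> by simp
  have "W \<in> connected_components_of (subtopology (Euclidean_space n) M)"
    unfolding W_def connected_components_of_def using uM by (rule imageI)
  \<comment> \<open>Components of an open set are open because Euclidean space is locally
    connected.\<close>
  then have W: "is_domain n W"
    using locally_connected_space_open_connected_components[THEN iffD1,
        OF locally_connected_Euclidean_space] M by blast
  have connW: "connectedin (subtopology (Euclidean_space n) M) W"
    unfolding W_def by (rule connectedin_connected_component_of)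
  have "u \<in> W"
    using uM by (simp add: W_def connected_component_of_refl)
  have WM: "W \<subseteq> M"
    using connectedin_subset_topspace[OF connW] by auto
  have "M \<subseteq> N"
  proof
    fix x assume "x \<in> M"
    then have "mat_action n (1\<^sub>m n) x \<in> N" "x \<in> topspace (Euclidean_space n)"
      using facts(3) by (auto simp: M_def)
    then show "x \<in> N"
      by (simp add: mat_action_one)
  qed
  have "mat_action n A ` W \<subseteq> W" if A: "A \<in> H" for A
  proof -
    have "mat_action n A x \<in> M" if "x \<in> M" for x
    proof -
      \<comment> \<open>\<open>B * A\<close> lies in \<open>H\<close>, so the condition defining
        \<open>M\<close> applies to it at \<open>x\<close>.\<close>
      have "mat_action n B (mat_action n A x) \<in> N" if "B \<in> H" for B
        using \<open>x \<in> M\<close> facts(1,2) that A by (simp add: M_def flip: mat_action_mult)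
      then show ?thesis
        by (simp add: M_def mat_action_def topspace_Euclidean_space)
    qed
    then have "continuous_map (subtopology (Euclidean_space n) M) (subtopology (Euclidean_space n) M) (mat_action n A)"
      using continuous_map_mat_action
      by (auto simp: continuous_map_in_subtopology intro: continuous_map_from_subtopology)
    from connectedin_continuous_map_image[OF this connW]
    have "connectedin (subtopology (Euclidean_space n) M) (mat_action n A ` W)" .
    moreover have "u \<in> mat_action n A ` W"
      using fix_u[OF A] \<open>u \<in> W\<close> by (metis imageI)
    ultimately show ?thesis
      unfolding W_def by (rule connected_component_of_maximal)
  qed
  moreover have "connectedin (Euclidean_space n) W"
    using connW by (simp add: connectedin_subtopology)
  ultimately show ?thesis
    using that W \<open>u \<in> W\<close> WM \<open>M \<subseteq> N\<close> by blast
qed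

text \<open>Separate \<open>u\<close> and its image by disjoint open sets \<open>C\<close> and
  \<open>D\<close>; the points of \<open>C\<close> that \<open>A\<close> sends into \<open>D\<close>
  leave \<open>C\<close>.\<close>

lemma neighbourhood_moved_off_itself:
  assumes u: "u \<in> topspace (Euclidean_space n)" and Au: "mat_action n A u \<noteq> u"
  obtains N where "is_domain n N" "u \<in> N" "\<And>x. x \<in> N \<Longrightarrow> mat_action n A x \<notin> N"
proof -
  have "mat_action n A u \<in> topspace (Euclidean_space n)"
    by (simp add: mat_action_def topspace_Euclidean_space)
  then obtain C D where CD: "is_domain n C" "is_domain n D" "u \<in> C" "mat_action n A u \<in> D" "disjnt C D"
    using Hausdorff_Euclidean_space[of n] u Au unfolding Hausdorff_space_def by metis
  let ?N = "C \<inter> {x \<in> topspace (Euclidean_space n). mat_action n A x \<in> D}"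
  have "is_domain n ?N"
    using openin_continuous_map_preimage[OF continuous_map_mat_action] CD by blast
  then show ?thesis
    by (rule that) (use CD u in \<open>auto simp: disjnt_iff\<close>)
qed


section \<open>Charts as plots with local lifting\<close>

context diffeological_space
begin

lemma plot_domain: "(n, U, P) \<in> plots X \<Longrightarrow> is_domain n U"
  and plot_PiE: "(n, U, P) \<in> plots X \<Longrightarrow> P \<in> U \<rightarrow>\<^sub>E points X"
  using plots_parametrizations by (auto simp: parametrizations_def)

lemma plot_restrict:
  assumes P: "(n, U, P) \<in> plots X" and "is_domain n V" and "V \<subseteq> U"
  shows "(n, V, restrict P V) \<in> plots X"
proof -
  have "(n, V, compose V P (restrict id V)) \<in> plots X"
    using smooth_compatibility[OF P smooth_domain_map_inclusion] assms plot_domain[OF P] by blast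
  moreover have "compose V P (restrict id V) = restrict P V"
    by (auto simp: compose_def)
  ultimately show ?thesis by simp
qed

text \<open>The gluing axiom in pointwise form, as used for maps known to be plots only near each
  point.\<close>

lemma plot_locally:
  assumes "Q \<in> extensional V"
    and loc: "\<And>v. v \<in> V \<Longrightarrow> \<exists>W P. v \<in> W \<and> W \<subseteq> V \<and> (n, W, P) \<in> plots X \<and> (\<forall>w\<in>W. Q w = P w)"
  shows "(n, V, Q) \<in> plots X"
proof -
  \<comment> \<open>All plots that agree with \<open>Q\<close> on a part of \<open>V\<close>: having
    \<open>Q\<close> as common extension, they are compatible on overlaps.\<close>
  let ?F = "{(W, P). W \<subseteq> V \<and> (n, W, P) \<in> plots X \<and> (\<forall>w\<in>W. Q w = P w)}"
  have V: "(\<Union>(W, P)\<in>?F. W) = V"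
  proof
    show "V \<subseteq> (\<Union>(W, P)\<in>?F. W)"
    proof
      fix v assume "v \<in> V"
      from loc[OF this] obtain W P where "v \<in> W" "(W, P) \<in> ?F" by auto
      then show "v \<in> (\<Union>(W, P)\<in>?F. W)" by blast
    qed
  qed auto
  have "(n, \<Union>(W, P)\<in>?F. W, Q) \<in> plots X"
    by (rule gluing) (use assms(1) in \<open>auto simp: V\<close>)
  then show ?thesis unfolding V .
qed

end

section \<open>Plots of domains and of pullbacks\<close>

lemma plots_domain_space:
  "(m, V, F) \<in> plots (domain_space n U) \<longleftrightarrow> F \<in> extensional V \<and> smooth_domain_map m V n U F"
  by (auto simp: domain_space_def parametrizations_def smooth_domain_map_def PiE_def)

lemma points_domain_space [simp]: "points (domain_space n U) = U"
  by (simp add: domain_space_def)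

lemma id_plot_domain_space:
  "is_domain n B \<Longrightarrow> is_domain n U \<Longrightarrow> B \<subseteq> U \<Longrightarrow> (n, B, restrict id B) \<in> plots (domain_space n U)"
  by (simp add: plots_domain_space smooth_domain_map_inclusion)

lemma plots_pullback_space:
  assumes "diffeological_space E"
  shows "(m, V, F) \<in> plots (pullback_space (domain_space n U) E q p) \<longleftrightarrow>
    F \<in> extensional V \<and> smooth_domain_map m V n U (compose V fst F) \<and>
    (m, V, compose V snd F) \<in> plots E \<and> (\<forall>v\<in>V. q (fst (F v)) = p (snd (F v)))"
    (is "?L \<longleftrightarrow> ?R")
proof
  interpret diffeological_space E by fact
  show "?L \<Longrightarrow> ?R"
    by (auto simp: pullback_space_def subspace_of_def product_space_def parametrizations_def
        plots_domain_space PiE_def)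
  assume R: ?R
  have "F v \<in> U \<times> points E" if "v \<in> V" for v
    using R that PiE_mem[OF plot_PiE[of m V "compose V snd F"], of v]
      funcset_mem[of "compose V fst F" V U v]
    by (simp add: smooth_domain_map_def compose_def mem_Times_iff)
  then have "F \<in> V \<rightarrow>\<^sub>E U \<times> points E" "F ` V \<subseteq> {(z, x) \<in> U \<times> points E. q z = p x}"
    using R by (force simp: PiE_def Pi_def)+
  moreover have "is_domain m V"
    using R by (simp add: smooth_domain_map_def)
  ultimately show ?L
    using R by (simp add: pullback_space_def subspace_of_def product_space_def parametrizations_def
        plots_domain_space)
qed

text \<open>
  A chart is kept as the composite \<open>q : U \<rightarrow> X\<close> of the quotient map with the diffeomorphism
  from \<open>U/G\<close>. That this diffeomorphism has D-open image and smooth inverse then becomes one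
  statement: plots meeting the image lift locally along \<open>q\<close>.
\<close>

definition orbifold_chart ::
    "nat \<Rightarrow> real mat set \<Rightarrow> (nat \<Rightarrow> real) set \<Rightarrow> 'a dspace \<Rightarrow> ((nat \<Rightarrow> real) \<Rightarrow> 'a) \<Rightarrow> bool" where
  "orbifold_chart n G U X q \<longleftrightarrow>
     finite G \<and> subgroup G (GL_group n) \<and> is_domain n U \<and> connectedin (Euclidean_space n) U \<and>
     (\<forall>A\<in>G. mat_action n A ` U \<subseteq> U) \<and> (n, U, q) \<in> plots X \<and>
     (\<forall>u\<in>U. \<forall>v\<in>U. q u = q v \<longleftrightarrow> (u, v) \<in> orbit_relation n G U) \<and>
     (\<forall>(m, V, P) \<in> plots X. \<forall>v\<in>V. P v \<in> q ` U \<longrightarrow>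
        (\<exists>N R. v \<in> N \<and> N \<subseteq> V \<and> smooth_domain_map m N n U R \<and> (\<forall>w\<in>N. P w = q (R w))))"

text \<open>Local lifts along \<open>q\<close> come from the quotient diffeology: the inverse of
  \<open>f\<close> turns a plot with values in \<open>U'\<close> into a plot of \<open>U/G\<close>,
  which by definition lifts locally to \<open>U\<close>.\<close>

lemma orbifold_chart_exists:
  assumes X: "diffeological_orbifold_dim n X" and x: "x \<in> points X"
  obtains G U q where "orbifold_chart n G U X q" and "x \<in> q ` U"
proof -
  interpret diffeological_space X
    using X by (simp add: diffeological_orbifold_dim_def)
  obtain U' G U f where U': "D_open X U'" "x \<in> U'" and G: "finite G" "subgroup G (GL_group n)"
    and U: "is_domain n U" "connectedin (Euclidean_space n) U" "\<forall>A\<in>G. mat_action n A ` U \<subseteq> U"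
    and f: "diffeomorphism (quotient_space (domain_space n U) (orbit_relation n G U)) (subspace_of X U') f"
    using bspec[OF conjunct2[OF X[unfolded diffeological_orbifold_dim_def]] x]
    by (elim exE conjE) (rule that)
  define R where "R = orbit_relation n G U"
  define q where "q = (\<lambda>u\<in>U. f (R `` {u}))"
  have R: "equiv U R"
    unfolding R_def
    by (rule equiv_orbit_relation[OF G(2) openin_subset[OF U(1)]]) (use U(3) in blast)
  have bij: "bij_betw f (U // R) U'"
    and f1: "dsmooth (quotient_space (domain_space n U) R) (subspace_of X U') f"
    and f2: "dsmooth (subspace_of X U') (quotient_space (domain_space n U) R) (inv_into (U // R) f)"
    using f by (simp_all add: diffeomorphism_def quotient_space_def subspace_of_def R_def)
  \<comment> \<open>The quotient map is a plot, lifted on all of \<open>U\<close> by the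
    identity.\<close>
  have "(n, U, \<lambda>u\<in>U. R `` {u}) \<in> plots (quotient_space (domain_space n U) R)"
    using U(1) id_plot_domain_space[OF U(1) U(1) subset_refl]
    by (auto simp: quotient_space_def parametrizations_def quotientI intro!: exI[of _ U] exI[of _ "restrict id U"])
  then have "(n, U, compose U f (\<lambda>u\<in>U. R `` {u})) \<in> plots X"
    using f1 by (auto simp: dsmooth_def subspace_of_def)
  moreover have "compose U f (\<lambda>u\<in>U. R `` {u}) = q"
    by (auto simp: q_def compose_def)
  ultimately have q: "(n, U, q) \<in> plots X" by simp
  have q_eq: "q u = q v \<longleftrightarrow> (u, v) \<in> R" if "u \<in> U" "v \<in> U" for u v
  proof -
    have "q u = q v \<longleftrightarrow> R `` {u} = R `` {v}"
      using inj_on_eq_iff[OF bij_betw_imp_inj_on[OF bij] quotientI[OF that(1)] quotientI[OF that(2)]] that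
      by (simp add: q_def)
    then show ?thesis
      using eq_equiv_class_iff[OF R that] by simp
  qed
  have q_image: "q ` U = U'"
  proof -
    have "q ` U = f ` (U // R)"
      by (auto simp: q_def quotient_def)
    then show ?thesis
      using bij by (simp add: bij_betw_def)
  qed
  have "\<exists>N S. v \<in> N \<and> N \<subseteq> V \<and> smooth_domain_map m N n U S \<and> (\<forall>w\<in>N. P w = q (S w))"
    if P: "(m, V, P) \<in> plots X" and v: "v \<in> V" "P v \<in> q ` U" for m V P v
  proof -
    \<comment> \<open>D-openness of \<open>U'\<close> makes this part of \<open>V\<close> a domain,
      so \<open>P\<close> restricts to a plot with values in \<open>U'\<close>.\<close>
    let ?V = "V \<inter> P -` U'"
    have "is_domain m ?V"
      using U'(1) P unfolding D_open_def by blast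
    then have "(m, ?V, restrict P ?V) \<in> plots (subspace_of X U')"
      using plot_restrict[OF P] by (auto simp: subspace_of_def)
    then have "(m, ?V, compose ?V (inv_into (U // R) f) (restrict P ?V)) \<in>
        plots (quotient_space (domain_space n U) R)"
      using f2 by (auto simp: dsmooth_def)
    then have "\<forall>v\<in>?V. \<exists>N S. v \<in> N \<and> N \<subseteq> ?V \<and> (m, N, S) \<in> plots (domain_space n U) \<and>
        (\<forall>w\<in>N. compose ?V (inv_into (U // R) f) (restrict P ?V) w = R `` {S w})"
      by (simp only: quotient_space_def dspace.simps mem_Collect_eq split_conv, elim conjunct2)
    moreover have "v \<in> ?V"
      using v q_image by simp
    ultimately obtain N S where N: "v \<in> N" "N \<subseteq> ?V" "(m, N, S) \<in> plots (domain_space n U)"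
      and S: "\<forall>w\<in>N. compose ?V (inv_into (U // R) f) (restrict P ?V) w = R `` {S w}"
      by meson
    have "P w = q (S w)" if "w \<in> N" for w
    proof -
      have w: "w \<in> ?V" using that N(2) by blast
      have "inv_into (U // R) f (P w) = R `` {S w}"
        using S[rule_format, OF that] w by (simp add: compose_def)
      moreover have "f (inv_into (U // R) f (P w)) = P w"
        using w bij by (auto simp: bij_betw_def intro!: f_inv_into_f)
      moreover have "S w \<in> U"
        using N(3) that by (auto simp: plots_domain_space smooth_domain_map_def)
      ultimately show ?thesis
        by (simp add: q_def)
    qed
    then show ?thesis
      using N by (auto simp: plots_domain_space)
  qed
  then have "orbifold_chart n G U X q"
    unfolding orbifold_chart_def using G U q q_eq by (auto simp flip: R_def)
  then show ?thesis
    using that q_image U'(2) by blast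
qed

text \<open>Converse to the extraction of a chart: the lifting clause yields both the D-open image
  and the smooth inverse of the map induced on the quotient.\<close>

lemma orbifold_chart_diffeomorphism:
  assumes "diffeological_space X" and chart: "orbifold_chart n G U X q"
  shows "D_open X (q ` U)"
    and "\<exists>f. diffeomorphism (quotient_space (domain_space n U) (orbit_relation n G U))
      (subspace_of X (q ` U)) f"
proof -
  interpret diffeological_space X by fact
  have G: "subgroup G (GL_group n)" and U: "is_domain n U" "\<And>A. A \<in> G \<Longrightarrow> mat_action n A ` U \<subseteq> U"
    and q: "(n, U, q) \<in> plots X"
    and q_eq: "\<And>u v. u \<in> U \<Longrightarrow> v \<in> U \<Longrightarrow> q u = q v \<longleftrightarrow> (u, v) \<in> orbit_relation n G U"
    using chart by (simp_all add: orbifold_chart_def)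
  have lift: "\<exists>N S. v \<in> N \<and> N \<subseteq> V \<and> smooth_domain_map m N n U S \<and> (\<forall>w\<in>N. P w = q (S w))"
    if "(m, V, P) \<in> plots X" "v \<in> V" "P v \<in> q ` U" for m V P v
    using chart that unfolding orbifold_chart_def by blast
  show "D_open X (q ` U)"
    unfolding D_open_def
  proof (intro conjI ballI, safe)
    show "q u \<in> points X" if "u \<in> U" for u
      using plot_PiE[OF q] that by (rule PiE_mem)
    fix m V P
    assume P: "(m, V, P) \<in> plots X"
    \<comment> \<open>The domain of a lift of \<open>P\<close> at \<open>v\<close> is an open
      neighbourhood of \<open>v\<close> on which \<open>P\<close> stays in the image of
      \<open>q\<close>.\<close>
    show "is_domain m (V \<inter> P -` q ` U)"
    proof (subst openin_subopen, intro ballI)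
      fix v assume "v \<in> V \<inter> P -` q ` U"
      then obtain N S where N: "v \<in> N" "N \<subseteq> V" "smooth_domain_map m N n U S"
        "\<forall>w\<in>N. P w = q (S w)"
        using lift[OF P, of v] by auto
      then have "N \<subseteq> V \<inter> P -` q ` U"
        by (fastforce simp: smooth_domain_map_def)
      then show "\<exists>T. is_domain m T \<and> v \<in> T \<and> T \<subseteq> V \<inter> P -` q ` U"
        using N by (auto simp: smooth_domain_map_def)
    qed
  qed
  define R where "R = orbit_relation n G U"
  \<comment> \<open>The factorization of \<open>q\<close> through the quotient. The choice of
    representative is harmless because \<open>q\<close> is constant on orbits.\<close>
  define f where "f c = q (SOME u. u \<in> c)" for c
  have R: "equiv U R"
    unfolding R_def by (rule equiv_orbit_relation[OF G openin_subset[OF U(1)] U(2)])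
  have f: "f (R `` {u}) = q u" if "u \<in> U" for u
  proof -
    have "u \<in> R `` {u}"
      using R that by (rule equiv_class_self)
    then have "(u, SOME v. v \<in> R `` {u}) \<in> R"
      using someI[of "\<lambda>v. v \<in> R `` {u}"] by blast
    moreover from this have "(SOME v. v \<in> R `` {u}) \<in> U"
      by (auto simp: R_def orbit_relation_def)
    ultimately have "q u = q (SOME v. v \<in> R `` {u})"
      using q_eq[OF that] unfolding R_def by blast
    then show ?thesis
      by (simp only: f_def)
  qed
  have bij: "bij_betw f (U // R) (q ` U)"
    unfolding bij_betw_def
  proof
    have "f ` (U // R) = (\<lambda>u. f (R `` {u})) ` U"
      by (auto simp: quotient_def)
    also have "\<dots> = q ` U"
      by (rule image_cong[OF refl f])
    finally show "f ` (U // R) = q ` U" .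
    show "inj_on f (U // R)"
    proof (rule inj_onI)
      fix c d
      assume "c \<in> U // R" "d \<in> U // R" "f c = f d"
      then obtain u v where uv: "u \<in> U" "v \<in> U" "c = R `` {u}" "d = R `` {v}"
        by (auto elim!: quotientE)
      then have "q u = q v"
        using \<open>f c = f d\<close> f by simp
      with uv show "c = d"
        using equiv_class_eq[OF R] q_eq R_def by blast
    qed
  qed
  let ?Q = "quotient_space (domain_space n U) R" and ?S = "subspace_of X (q ` U)"
  have "dsmooth ?Q ?S f"
    unfolding dsmooth_def
  proof (intro conjI ballI, goal_cases)
    case 1
    then show ?case
      using bij by (auto simp: quotient_space_def subspace_of_def bij_betw_def)
  next
    case (2 z)
    obtain m V P where z: "z = (m, V, P)" by (cases z)
    have P: "P \<in> V \<rightarrow>\<^sub>E U // R"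
      and loc: "\<forall>v\<in>V. \<exists>N S. v \<in> N \<and> N \<subseteq> V \<and> (m, N, S) \<in> plots (domain_space n U) \<and>
        (\<forall>w\<in>N. P w = R `` {S w})"
      using 2 by (simp_all add: z quotient_space_def parametrizations_def)
    have "(m, V, compose V f P) \<in> plots X"
    proof (rule plot_locally)
      fix v assume "v \<in> V"
      then obtain N S where N: "v \<in> N" "N \<subseteq> V" and S: "smooth_domain_map m N n U S"
        and PS: "\<forall>w\<in>N. P w = R `` {S w}"
        using loc by (auto simp: plots_domain_space)
      \<comment> \<open>Near \<open>v\<close> the composite is \<open>q\<close> after the smooth map
        \<open>S\<close>, hence a plot; gluing then covers all of \<open>V\<close>.\<close>
      have "compose V f P w = compose N q S w" if "w \<in> N" for w
      proof -
        have "S w \<in> U" using S that by (auto simp: smooth_domain_map_def)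
        then show ?thesis using that N(2) PS f by (auto simp: compose_def)
      qed
      then show "\<exists>W P'. v \<in> W \<and> W \<subseteq> V \<and> (m, W, P') \<in> plots X \<and> (\<forall>w\<in>W. compose V f P w = P' w)"
        using N smooth_compatibility[OF q S] by blast
    qed simp
    moreover have "compose V f P ` V \<subseteq> q ` U"
      using P bij by (auto simp: compose_def bij_betw_def)
    ultimately show ?case
      by (simp add: z subspace_of_def)
  qed
  moreover have "dsmooth ?S ?Q (inv_into (U // R) f)"
    unfolding dsmooth_def
  proof (intro conjI ballI, goal_cases)
    case 1
    then show ?case
      using bij_betw_inv_into[OF bij] by (auto simp: quotient_space_def subspace_of_def bij_betw_def)
  next
    case (2 z)
    obtain m V P where z: "z = (m, V, P)" by (cases z)
    have P: "(m, V, P) \<in> plots X" and PV: "P ` V \<subseteq> q ` U"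
      using 2 by (simp_all add: z subspace_of_def)
    let ?P = "compose V (inv_into (U // R) f) P"
    have "?P \<in> V \<rightarrow>\<^sub>E U // R"
    proof
      show "?P v \<in> U // R" if "v \<in> V" for v
      proof -
        have "P v \<in> q ` U" using PV that by blast
        then show ?thesis
          using bij_betwE[OF bij_betw_inv_into[OF bij]] that by (auto simp: compose_def)
      qed
    qed (simp add: compose_def)
    then have "(m, V, ?P) \<in> parametrizations (U // R)"
      using plot_domain[OF P] by (simp add: parametrizations_def)
    moreover have "\<exists>N S. v \<in> N \<and> N \<subseteq> V \<and> (m, N, S) \<in> plots (domain_space n U) \<and>
        (\<forall>w\<in>N. ?P w = R `` {S w})" if "v \<in> V" for v
    proof -
      have "P v \<in> q ` U"
        using PV \<open>v \<in> V\<close> by blast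
      then obtain N S where N: "v \<in> N" "N \<subseteq> V" and S: "smooth_domain_map m N n U S"
        and PS: "\<forall>w\<in>N. P w = q (S w)"
        using lift[OF P \<open>v \<in> V\<close>] by blast
      \<comment> \<open>Plots are extensional, so the lift enters as its restriction to
        \<open>N\<close>.\<close>
      have "?P w = R `` {restrict S N w}" if "w \<in> N" for w
      proof -
        have "S w \<in> U" using S that by (auto simp: smooth_domain_map_def)
        then have "P w = f (R `` {S w})" "R `` {S w} \<in> U // R"
          using PS that f by (simp_all add: quotientI)
        then show ?thesis
          using that N(2) bij by (auto simp: compose_def bij_betw_def)
      qed
      moreover have "smooth_domain_map m N n U (restrict S N)"
        using smooth_domain_map_restrict[OF S] S by (auto simp: smooth_domain_map_def)
      ultimately show ?thesis
        using N by (intro exI[of _ N] exI[of _ "restrict S N"]) (simp add: plots_domain_space)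
    qed
    ultimately show ?case
      by (simp add: z quotient_space_def)
  qed
  ultimately have "diffeomorphism ?Q ?S f"
    using bij by (simp add: diffeomorphism_def quotient_space_def subspace_of_def)
  then show "\<exists>f. diffeomorphism (quotient_space (domain_space n U) (orbit_relation n G U)) ?S f"
    unfolding R_def by blast
qed

lemma diffeological_orbifold_dimI:
  assumes X: "diffeological_space X"
    and charts: "\<And>x. x \<in> points X \<Longrightarrow> \<exists>G U q. orbifold_chart n G U X q \<and> x \<in> q ` U"
  shows "diffeological_orbifold_dim n X"
  unfolding diffeological_orbifold_dim_def
proof (intro conjI ballI X)
  fix x assume "x \<in> points X"
  then obtain G U q where chart: "orbifold_chart n G U X q" and x: "x \<in> q ` U"
    using charts by blast
  obtain f where "diffeomorphism (quotient_space (domain_space n U) (orbit_relation n G U))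
      (subspace_of X (q ` U)) f"
    using orbifold_chart_diffeomorphism(2)[OF X chart] by blast
  then show "\<exists>U' G U f. D_open X U' \<and> x \<in> U' \<and> finite G \<and> subgroup G (GL_group n) \<and>
      is_domain n U \<and> connectedin (Euclidean_space n) U \<and> (\<forall>A\<in>G. mat_action n A ` U \<subseteq> U) \<and>
      diffeomorphism (quotient_space (domain_space n U) (orbit_relation n G U)) (subspace_of X U') f"
    using orbifold_chart_diffeomorphism(1)[OF X chart] x chart[unfolded orbifold_chart_def]
    by (intro exI[of _ "q ` U"] exI[of _ G] exI[of _ U] exI[of _ f]) (elim conjE, intro conjI)
qed


section \<open>Lifting charts along diffeological etale maps\<close>

text \<open>\<open>T\<close> is a sheet of the pullback through \<open>(u, e)\<close>, carried
  diffeomorphically onto \<open>B\<close> by \<open>fst\<close>; the second component of the inverse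
  is \<open>s\<close>. The last conclusion, with \<open>(b, s b)\<close> in \<open>T\<close>, says
  that \<open>T\<close> is the graph of \<open>s\<close>.\<close>

lemma etale_map_local_section:
  assumes E: "diffeological_space E" and U: "is_domain n U"
    and etale: "etale_map (pullback_space (domain_space n U) E q p) (domain_space n U) fst"
    and u: "u \<in> U" and e: "e \<in> points E" and ue: "q u = p e"
  obtains T B s where "D_open (pullback_space (domain_space n U) E q p) T" and "is_domain n B"
    and "B \<subseteq> U" and "u \<in> B" and "(n, B, s) \<in> plots E" and "s u = e"
    and "\<And>b. b \<in> B \<Longrightarrow> (b, s b) \<in> T" and "\<And>b. b \<in> B \<Longrightarrow> q b = p (s b)"
    and "\<And>b d. (b, d) \<in> T \<Longrightarrow> d = s b"
proof -
  let ?PB = "pullback_space (domain_space n U) E q p"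
  have pts: "points ?PB = {(b, d). b \<in> U \<and> d \<in> points E \<and> q b = p d}"
    by (auto simp: pullback_space_def subspace_of_def)
  have "(u, e) \<in> points ?PB"
    using u e ue by (simp add: pts)
  then obtain T B where T: "D_open ?PB T" "(u, e) \<in> T" and B: "D_open (domain_space n U) B" "u \<in> B"
    and diff: "diffeomorphism (subspace_of ?PB T) (subspace_of (domain_space n U) B) (restrict fst T)"
    using etale unfolding etale_map_def by (metis fst_conv)
  have BU: "B \<subseteq> U"
    using B(1) by (simp add: D_open_def)
  \<comment> \<open>Testing D-openness of \<open>B\<close> on the identity plot shows that
    \<open>B\<close> is a domain.\<close>
  have "(n, U, restrict id U) \<in> plots (domain_space n U)"
    using U by (simp add: id_plot_domain_space)
  then have "is_domain n (U \<inter> restrict id U -` B)"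
    using B(1) by (auto simp: D_open_def)
  moreover have "U \<inter> restrict id U -` B = B"
    using BU by auto
  ultimately have Bdom: "is_domain n B" by simp
  have bij: "bij_betw (restrict fst T) T B"
    and inv: "dsmooth (subspace_of (domain_space n U) B) (subspace_of ?PB T) (inv_into T (restrict fst T))"
    using diff by (simp_all add: diffeomorphism_def subspace_of_def)
  define t where "t = inv_into T (restrict fst T)"
  have tT: "t b \<in> T" and fst_t: "fst (t b) = b" if "b \<in> B" for b
  proof -
    show "t b \<in> T"
      using bij_betwE[OF bij_betw_inv_into[OF bij]] that by (simp add: t_def)
    then show "fst (t b) = b"
      using bij_betw_inv_into_right[OF bij that] by (simp add: t_def)
  qed
  define s where "s = (\<lambda>b\<in>B. snd (t b))"
  have sT: "(b, s b) \<in> T" if "b \<in> B" for b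
    using tT[OF that] fst_t[OF that] that by (metis prod.collapse restrict_apply' s_def)
  have s_unique: "d = s b" if "(b, d) \<in> T" for b d
  proof -
    have "b \<in> B"
      using bij_betwE[OF bij] that by fastforce
    then have "(b, d) = (b, s b)"
      using bij_betw_imp_inj_on[OF bij] that sT by (auto dest!: inj_onD[of _ _ "(b, d)" "(b, s b)"])
    then show ?thesis by simp
  qed
  \<comment> \<open>The smooth inverse \<open>t\<close> sends the identity plot of \<open>B\<close>
    to a plot of the pullback, whose second component is a plot of \<open>E\<close>.\<close>
  have "(n, B, restrict id B) \<in> plots (subspace_of (domain_space n U) B)"
    using id_plot_domain_space[OF Bdom U BU] by (simp add: subspace_of_def)
  then have "(n, B, compose B t (restrict id B)) \<in> plots ?PB"
    using inv unfolding dsmooth_def t_def[symmetric] by (auto simp: subspace_of_def)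
  then have "(n, B, compose B snd (compose B t (restrict id B))) \<in> plots E"
    unfolding plots_pullback_space[OF E] by blast
  moreover have "compose B snd (compose B t (restrict id B)) = s"
    by (auto simp: compose_def s_def)
  ultimately have "(n, B, s) \<in> plots E" by simp
  moreover have "q b = p (s b)" if "b \<in> B" for b
    using sT[OF that] T(1) by (auto simp: D_open_def pts)
  ultimately show ?thesis
    using that[of T B s] T B(2) Bdom BU sT s_unique by blast
qed

text \<open>\<open>R\<close> and \<open>P\<close> combine to a plot of the pullback, so lying on the
  sheet \<open>T\<close> is an open condition on the parameter.\<close>

lemma D_open_pullback_preimage:
  assumes E: "diffeological_space E" and T: "D_open (pullback_space (domain_space n U) E q p) T"
    and R: "smooth_domain_map m V n U R" and P: "(m, V, P) \<in> plots E"
    and eq: "\<And>v. v \<in> V \<Longrightarrow> q (R v) = p (P v)"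
  shows "is_domain m {v \<in> V. (R v, P v) \<in> T}"
proof -
  let ?F = "\<lambda>v\<in>V. (R v, P v)"
  have V: "is_domain m V" and U: "is_domain n U" and "R \<in> V \<rightarrow> U"
    using R by (auto simp: smooth_domain_map_def)
  then have "smooth_domain_map m V n U (restrict R V)"
    using smooth_domain_map_restrict[OF R V _ U] by blast
  moreover have "compose V fst ?F = restrict R V"
    by (auto simp: compose_def)
  moreover have "compose V snd ?F = P"
    using diffeological_space.plot_PiE[OF E P] by (auto simp: compose_def PiE_def extensional_def)
  ultimately have "(m, V, ?F) \<in> plots (pullback_space (domain_space n U) E q p)"
    using P eq by (simp add: plots_pullback_space[OF E])
  then have "is_domain m (V \<inter> ?F -` T)"
    using T by (auto simp: D_open_def)
  moreover have "V \<inter> ?F -` T = {v \<in> V. (R v, P v) \<in> T}"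
    by auto
  ultimately show ?thesis by simp
qed

text \<open>
  The stabilizer \<open>H\<close> of \<open>u\<close> fixes \<open>(u, e)\<close> in the pullback, so near \<open>u\<close> the translates
  \<open>x \<mapsto> (x, s (h x))\<close> stay in the sheet \<open>T\<close>, which forces \<open>s (h x) = s x\<close>: the section \<open>s\<close>
  descends to the quotient by \<open>H\<close>.
\<close>

lemma orbifold_chart_lift:
  assumes E: "diffeological_space E" and et: "diffeological_etale_map E X p"
    and chart: "orbifold_chart n G U X q" and e: "e \<in> points E" and pe: "p e \<in> q ` U"
  obtains H W s where "orbifold_chart n H W E s" and "e \<in> s ` W"
proof -
  interpret E: diffeological_space E by fact
  have G: "finite G" "subgroup G (GL_group n)" and U: "is_domain n U"
    and inv: "\<And>A. A \<in> G \<Longrightarrow> mat_action n A ` U \<subseteq> U"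
    and q: "(n, U, q) \<in> plots X"
    and q_eq: "\<And>u v. u \<in> U \<Longrightarrow> v \<in> U \<Longrightarrow> q u = q v \<longleftrightarrow> (u, v) \<in> orbit_relation n G U"
    using chart by (simp_all add: orbifold_chart_def)
  have lift: "\<exists>N S. v \<in> N \<and> N \<subseteq> V \<and> smooth_domain_map m N n U S \<and> (\<forall>w\<in>N. P w = q (S w))"
    if "(m, V, P) \<in> plots X" "v \<in> V" "P v \<in> q ` U" for m V P v
    using chart that unfolding orbifold_chart_def by blast
  have q_inv: "q (mat_action n A x) = q x" if "A \<in> G" "x \<in> U" for A x
  proof -
    have "mat_action n A x \<in> U"
      using inv that by blast
    then show ?thesis
      using q_eq[of x "mat_action n A x"] that by (auto simp: orbit_relation_def)
  qed
  obtain u where u: "u \<in> U" "q u = p e"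
    using pe by force
  then have u_top: "u \<in> topspace (Euclidean_space n)"
    using openin_subset[OF U] by blast
  have "etale_map (pullback_space (domain_space n U) E q p) (domain_space n U) fst"
    using et q by (auto simp: diffeological_etale_map_def)
  from etale_map_local_section[OF E U this u(1) e u(2)]
  obtain T B s where T: "D_open (pullback_space (domain_space n U) E q p) T"
    and B: "is_domain n B" "B \<subseteq> U" "u \<in> B" and s: "(n, B, s) \<in> plots E" "s u = e"
    and sT: "\<And>b. b \<in> B \<Longrightarrow> (b, s b) \<in> T" and qs: "\<And>b. b \<in> B \<Longrightarrow> q b = p (s b)"
    and s_unique: "\<And>b d. (b, d) \<in> T \<Longrightarrow> d = s b"
    by blast
  define H where "H = {A \<in> G. mat_action n A u = u}"
  have H: "subgroup H (GL_group n)" "finite H"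
    using subgroup_GL_stabilizer[OF G(2) u_top] G(1) by (simp_all add: H_def)
  \<comment> \<open>One neighbourhood for each element of \<open>G\<close>. Both requirements sit in
    one formula so that a single choice produces the whole family.\<close>
  have "\<exists>N. is_domain n N \<and> u \<in> N \<and>
      (if A \<in> H then \<forall>x\<in>N. s (mat_action n A x) = s x else \<forall>x\<in>N. mat_action n A x \<notin> N)"
    if A: "A \<in> G" for A
  proof (cases "A \<in> H")
    case True
    \<comment> \<open>The points at which \<open>s\<close> can be evaluated after moving by
      \<open>A\<close>; \<open>u\<close> is among them because \<open>A\<close> fixes it.\<close>
    define V where "V = {b \<in> B. mat_action n A b \<in> B}"
    have id: "smooth_domain_map n B n U (restrict id B)"
      by (rule smooth_domain_map_inclusion[OF B(1) U B(2)])
    have act: "smooth_domain_map n B n U (\<lambda>b\<in>B. mat_action n A (restrict id B b))"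
      by (rule smooth_domain_map_mat_action[OF id inv[OF A]])
    have V_eq: "V = {b \<in> B. (\<lambda>b\<in>B. mat_action n A (restrict id B b)) b \<in> B}"
      by (auto simp: V_def)
    have V: "is_domain n V"
      unfolding V_eq by (rule openin_smooth_domain_map_preimage[OF act B(1)])
    have VB: "V \<subseteq> B" by (auto simp: V_def)
    define R where "R = restrict (\<lambda>b\<in>B. mat_action n A (restrict id B b)) V"
    have R: "smooth_domain_map n V n B R"
      unfolding R_def by (rule smooth_domain_map_restrict[OF act V VB B(1)]) (auto simp: V_def)
    have R_apply: "R x = mat_action n A x" if "x \<in> V" for x
      using that VB by (auto simp: R_def)
    have sR: "(n, V, compose V s R) \<in> plots E"
      by (rule E.smooth_compatibility[OF s(1) R])
    have idV: "smooth_domain_map n V n U (restrict id V)"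
      using smooth_domain_map_inclusion[OF V U] VB B(2) by blast
    have qR: "q (restrict id V x) = p (compose V s R x)" if "x \<in> V" for x
    proof -
      have "x \<in> U" "mat_action n A x \<in> B"
        using that B(2) by (auto simp: V_def)
      then show ?thesis
        using qs[of "mat_action n A x", symmetric] q_inv[OF A] that by (simp add: compose_def R_apply)
    qed
    \<comment> \<open>Contains \<open>u\<close> because \<open>(u, s u)\<close> is in
      \<open>T\<close>. As \<open>T\<close> is the graph of \<open>s\<close>, membership of
      \<open>(x, s (A x))\<close> forces \<open>s (A x) = s x\<close>.\<close>
    define N where "N = {x \<in> V. (restrict id V x, compose V s R x) \<in> T}"
    have "is_domain n N"
      unfolding N_def by (rule D_open_pullback_preimage[OF E T idV sR qR])
    moreover have "u \<in> N"
      using True B(3) sT[OF B(3)] by (simp add: N_def V_def H_def compose_def R_apply)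
    moreover have "s (mat_action n A x) = s x" if "x \<in> N" for x
    proof -
      have "x \<in> V" "(x, s (mat_action n A x)) \<in> T"
        using that by (auto simp: N_def compose_def R_apply)
      then show ?thesis
        using s_unique by blast
    qed
    ultimately show ?thesis
      using True by (intro exI[of _ N]) simp
  next
    case False
    then have "mat_action n A u \<noteq> u"
      using A by (simp add: H_def)
    from neighbourhood_moved_off_itself[OF u_top this] obtain N where
      "is_domain n N" "u \<in> N" "\<And>x. x \<in> N \<Longrightarrow> mat_action n A x \<notin> N" by blast
    then show ?thesis
      using False by (intro exI[of _ N]) simp
  qed
  then have "\<forall>A\<in>G. \<exists>N. is_domain n N \<and> u \<in> N \<and>
      (if A \<in> H then \<forall>x\<in>N. s (mat_action n A x) = s x else \<forall>x\<in>N. mat_action n A x \<notin> N)"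
    by (rule ballI)
  from bchoice[OF this] obtain N where N_all: "\<forall>A\<in>G. is_domain n (N A) \<and> u \<in> N A \<and>
      (if A \<in> H then \<forall>x\<in>N A. s (mat_action n A x) = s x else \<forall>x\<in>N A. mat_action n A x \<notin> N A)"
    by (rule exE)
  have N: "is_domain n (N A)" "u \<in> N A" if "A \<in> G" for A
    using bspec[OF N_all that] by simp_all
  have NH: "s (mat_action n A x) = s x" if "A \<in> G" "A \<in> H" "x \<in> N A" for A x
    using bspec[OF N_all that(1)] that by simp
  have NG: "mat_action n A x \<notin> N A" if "A \<in> G" "A \<notin> H" "x \<in> N A" for A x
    using bspec[OF N_all that(1)] that by simp
  \<comment> \<open>Open since \<open>G\<close> is finite; it imposes the requirements for all
    elements of \<open>G\<close> at once.\<close>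
  let ?M = "\<Inter> (insert B (N ` G))"
  have M: "is_domain n ?M"
    using N(1) B(1) G(1) by (intro openin_Inter) auto
  have uM: "u \<in> ?M"
    using N(2) B(3) by blast
  obtain W where W: "is_domain n W" "connectedin (Euclidean_space n) W" "u \<in> W"
    and WM: "W \<subseteq> ?M" and W_inv: "\<And>A. A \<in> H \<Longrightarrow> mat_action n A ` W \<subseteq> W"
    using invariant_connected_neighbourhood[OF H M uM] unfolding H_def by blast
  have WB: "W \<subseteq> B" and WN: "\<And>A. A \<in> G \<Longrightarrow> W \<subseteq> N A"
    using WM by auto
  have WU: "W \<subseteq> U" using WB B(2) by blast
  define t where "t = restrict s W"
  have t: "(n, W, t) \<in> plots E"
    unfolding t_def by (rule E.plot_restrict[OF s(1) W(1) WB])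
  have t_eq: "t x = t y \<longleftrightarrow> (x, y) \<in> orbit_relation n H W" if "x \<in> W" "y \<in> W" for x y
  proof
    assume "t x = t y"
    then have "s x = s y"
      using that by (simp add: t_def)
    then have "q x = q y"
      using that WB qs by (metis subsetD)
    then obtain A where A: "A \<in> G" "y = mat_action n A x"
      using q_eq[OF subsetD[OF WU \<open>x \<in> W\<close>] subsetD[OF WU \<open>y \<in> W\<close>]]
      by (auto simp: orbit_relation_def)
    \<comment> \<open>\<open>x\<close> and its image \<open>y\<close> both lie in \<open>W\<close>,
      hence in \<open>N A\<close>, which an element outside \<open>H\<close> would move off
      itself.\<close>
    have "A \<in> H"
      using NG[OF A(1), of x] that WN[OF A(1)] A(2) by blast
    then show "(x, y) \<in> orbit_relation n H W"
      using A that by (auto simp: orbit_relation_def)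
  next
    assume "(x, y) \<in> orbit_relation n H W"
    then obtain A where A: "A \<in> H" "y = mat_action n A x"
      by (auto simp: orbit_relation_def)
    then have "A \<in> G" by (simp add: H_def)
    then have "s y = s x"
      using NH[of A x] A that WN by blast
    then show "t x = t y"
      using that by (simp add: t_def)
  qed
  have t_lift: "\<exists>N S. v \<in> N \<and> N \<subseteq> V \<and> smooth_domain_map m N n W S \<and> (\<forall>x\<in>N. P x = t (S x))"
    if P: "(m, V, P) \<in> plots E" and v: "v \<in> V" "P v \<in> t ` W" for m V P v
  proof -
    obtain w where w: "w \<in> W" "P v = s w"
      using v(2) by (auto simp: t_def)
    have pP: "(m, V, compose V p P) \<in> plots X"
      using et P by (auto simp: diffeological_etale_map_def dsmooth_def)
    have "compose V p P v = q w"
      using v(1) w qs[of w] WB by (auto simp: compose_def)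
    moreover have "q w \<in> q ` U"
      using w(1) WU by blast
    ultimately have "compose V p P v \<in> q ` U"
      by simp
    from lift[OF pP v(1) this] obtain N1 S where N1: "v \<in> N1" "N1 \<subseteq> V"
      and S: "smooth_domain_map m N1 n U S" and PS: "\<forall>x\<in>N1. compose V p P x = q (S x)"
      by (elim exE conjE)
    have S_U: "S x \<in> U" if "x \<in> N1" for x
      using S that by (auto simp: smooth_domain_map_def)
    have N1_dom: "is_domain m N1"
      using S by (simp add: smooth_domain_map_def)
    have "q (S v) = q w"
      using bspec[OF PS N1(1)] \<open>compose V p P v = q w\<close> by simp
    \<comment> \<open>The lift \<open>S\<close> through \<open>q\<close> meets only the
      \<open>G\<close>-orbit of \<open>w\<close>; translating it by \<open>A\<close> yields a lift
      \<open>S'\<close> with value \<open>w\<close> at \<open>v\<close>.\<close>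
    then obtain A where A: "A \<in> G" "w = mat_action n A (S v)"
      using q_eq[OF S_U[OF N1(1)] subsetD[OF WU w(1)]] by (auto simp: orbit_relation_def)
    define S' where "S' = (\<lambda>x\<in>N1. mat_action n A (S x))"
    have S': "smooth_domain_map m N1 n U S'"
      unfolding S'_def by (rule smooth_domain_map_mat_action[OF S inv[OF A(1)]])
    have P1: "(m, N1, restrict P N1) \<in> plots E"
      by (rule E.plot_restrict[OF P N1_dom N1(2)])
    have qS': "q (S' x) = p (restrict P N1 x)" if "x \<in> N1" for x
    proof -
      have "q (S' x) = q (S x)"
        using q_inv[OF A(1) S_U[OF that]] that by (simp add: S'_def)
      then show ?thesis
        using bspec[OF PS that] that subsetD[OF N1(2) that] by (simp add: compose_def)
    qed
    \<comment> \<open>At \<open>v\<close> the pair is \<open>(w, s w)\<close>, a point of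
      \<open>T\<close> with \<open>w\<close> in \<open>W\<close>; both conditions are open, so they
      persist near \<open>v\<close>.\<close>
    define N2 where "N2 = {x \<in> N1. (S' x, restrict P N1 x) \<in> T} \<inter> {x \<in> N1. S' x \<in> W}"
    have N2: "is_domain m N2"
      unfolding N2_def
      by (intro openin_Int D_open_pullback_preimage[OF E T S' P1 qS']
          openin_smooth_domain_map_preimage[OF S' W(1)])
    have "v \<in> N2"
      using N1(1) w A(2) sT[of w] WB by (auto simp: N2_def S'_def)
    moreover have "smooth_domain_map m N2 n W (restrict S' N2)"
      by (rule smooth_domain_map_restrict[OF S' N2 _ W(1)]) (auto simp: N2_def)
    moreover have "P x = t (restrict S' N2 x)" if "x \<in> N2" for x
    proof -
      \<comment> \<open>On the graph \<open>T\<close> the second component is determined by the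
        first, so \<open>P x = s (S' x)\<close>.\<close>
      have "(S' x, P x) \<in> T" "S' x \<in> W"
        using that by (auto simp: N2_def)
      then show ?thesis
        using s_unique that by (simp add: t_def)
    qed
    moreover have "N2 \<subseteq> V"
      using N1(2) by (auto simp: N2_def)
    ultimately show ?thesis
      by (intro exI[of _ N2] exI[of _ "restrict S' N2"]) simp
  qed
  have "\<forall>(m, V, P) \<in> plots E. \<forall>v\<in>V. P v \<in> t ` W \<longrightarrow>
      (\<exists>N S. v \<in> N \<and> N \<subseteq> V \<and> smooth_domain_map m N n W S \<and> (\<forall>x\<in>N. P x = t (S x)))"
  proof
    fix z assume z: "z \<in> plots E"
    obtain m V P where "z = (m, V, P)" by (cases z)
    then show "case z of (m, V, P) \<Rightarrow> \<forall>v\<in>V. P v \<in> t ` W \<longrightarrow>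
        (\<exists>N S. v \<in> N \<and> N \<subseteq> V \<and> smooth_domain_map m N n W S \<and> (\<forall>x\<in>N. P x = t (S x)))"
      using t_lift[of m V P] z by simp
  qed
  then have "orbifold_chart n H W E t"
    unfolding orbifold_chart_def using H W(1,2) W_inv t t_eq by simp
  moreover have "e \<in> t ` W"
    using W(3) s(2) by (auto simp: t_def image_iff)
  ultimately show ?thesis by (rule that)
qed

theorem theorem5p21:
  fixes \<O> :: "'b dspace" and \<E> :: "'a dspace" and \<pi> :: "'a \<Rightarrow> 'b"
  assumes "diffeological_orbifold \<O>"
    and "diffeological_space \<E>"
    and "diffeological_etale_map \<E> \<O> \<pi>"
  shows "diffeological_orbifold \<E>"
proof -
  obtain n where n: "diffeological_orbifold_dim n \<O>"
    using assms(1) by (auto simp: diffeological_orbifold_def)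
  \<comment> \<open>Charts are lifted over open subsets of charts of the base, so the dimension
    stays the same.\<close>
  have "diffeological_orbifold_dim n \<E>"
  proof (rule diffeological_orbifold_dimI[OF assms(2)])
    fix e assume e: "e \<in> points \<E>"
    then have "\<pi> e \<in> points \<O>"
      using assms(3) by (auto simp: diffeological_etale_map_def dsmooth_def)
    then obtain G U q where "orbifold_chart n G U \<O> q" "\<pi> e \<in> q ` U"
      by (rule orbifold_chart_exists[OF n])
    from orbifold_chart_lift[OF assms(2,3) this(1) e this(2)]
    show "\<exists>G U q. orbifold_chart n G U \<E> q \<and> e \<in> q ` U"
      by blast
  qed
  then show ?thesis
    by (auto simp: diffeological_orbifold_def)
qed

end
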